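(* Let $C_n$ denote the cycle on $n\geq 3$ vertices. Then $\chi_\rho''(C_3)=5$; $\chi_\rho''(C_n)=7$ for $n\in\{4,5\}$; $\chi_\rho''(C_6)=8$; $\chi_\rho''(C_n)=9$ for $n\in\{7,8,9,11\}$; $\chi_\rho''(C_n)=10$ for $n\in\{10,12\}$. Moreover, for every $n\geq 13$, $7\leq \chi_\rho''(C_n)\leq 11$.
   Context: All graphs are simple, finite and undirected. The total graph $T(G)$ of a graph $G$ has vertex set $V(G)\cup E(G)$, where two elements are adjacent if they are adjacent vertices of $G$, incident edges of $G$ (sharing an endpoint), or a vertex and an edge of $G$ having that vertex as an endpoint. A packing total coloring of $G$ is a map $c:V(G)\cup E(G)\to\{1,2,\dots\}$ such that for any two distinct elements $A,B\in V(G)\cup E(G)$ with $c(A)=c(B)=i$, the distance between $A$ and $B$ in $T(G)$ is greater than $i$. The packing total chromatic number $\chi_\rho''(G)$ is the smallest $k$ such that $G$ has a packing total coloring with colors from $\{1,\dots,k\}$. *)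

theory Defs
  imports "Graph_Theory.Pair_Digraph" "Graph_Theory.Shortest_Path"
begin

text \<open>
  A finite simple graph is a \<^locale>\<open>pair_graph\<close>: a finite, loop-free, symmetric digraph in which the
  undirected edge \<open>uv\<close> is represented by the two arcs \<open>(u, v)\<close> and \<open>(v, u)\<close>. As elements of the total
  graph, undirected edges are the two-element sets of their endpoints.
\<close>

definition uedges :: "'a pair_pre_digraph \<Rightarrow> 'a set set" where
  "uedges G = {{u, v} | u v. (u, v) \<in> parcs G}"

definition total_graph :: "'a pair_pre_digraph \<Rightarrow> ('a + 'a set) pair_pre_digraph" where
  "total_graph G =
     \<lparr> pverts = pverts G <+> uedges G,
       parcs = {(Inl u, Inl v) | u v. (u, v) \<in> parcs G}
             \<union> {(Inr e, Inr f) | e f. e \<in> uedges G \<and> f \<in> uedges G \<and> e \<noteq> f \<and> e \<inter> f \<noteq> {}}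
             \<union> {(Inl u, Inr e) | u e. e \<in> uedges G \<and> u \<in> e}
             \<union> {(Inr e, Inl u) | u e. e \<in> uedges G \<and> u \<in> e} \<rparr>"

lemma pair_graph_total_graph:
  assumes "pair_graph G"
  shows "pair_graph (total_graph G)"
proof -
  interpret pair_graph G by (fact assms)
  have fin_edges: "finite (uedges G)"
  proof -
    have "uedges G = (\<lambda>(u, v). {u, v}) ` parcs G"
      by (auto simp: uedges_def)
    then show ?thesis
      using pair_finite_arcs by simp
  qed
  have endpoints: "u \<in> pverts G" if "e \<in> uedges G" "u \<in> e" for u e
    using that by (auto simp: uedges_def dest: in_arcsD1 in_arcsD2)
  have sym: "(v, u) \<in> parcs G" if "(u, v) \<in> parcs G" for u v
    using pair_sym_arcs that by (auto simp: symmetric_def dest: symD)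
  have arcs: "parcs (total_graph G) \<subseteq> pverts (total_graph G) \<times> pverts (total_graph G)"
    by (auto simp: total_graph_def intro: endpoints dest: in_arcsD1 in_arcsD2)
  have verts: "finite (pverts (total_graph G))"
    using fin_edges pair_finite_verts by (simp add: total_graph_def)
  show ?thesis
  proof
    show "finite (parcs (total_graph G))"
      using finite_subset[OF arcs] verts by simp
    show "symmetric (with_proj (total_graph G))"
      by (auto simp: symmetric_def total_graph_def intro!: symI dest: sym)
    show "fst a \<noteq> snd a" if "a \<in> parcs (total_graph G)" for a
      using that by (auto simp: total_graph_def dest: pair_no_loops)
  qed (use arcs verts in auto)
qed

text \<open>
  Infimum of the lengths of all walks from \<open>u\<close> to \<open>v\<close>, hence \<open>\<infinity>\<close> if there is none. The constant
  \<^const>\<open>wf_digraph.\<mu>\<close> is specified only for well-formed digraphs.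
\<close>

definition graph_dist :: "'a pair_pre_digraph \<Rightarrow> 'a \<Rightarrow> 'a \<Rightarrow> ereal" where
  "graph_dist G u v = wf_digraph.\<mu> (with_proj G) (\<lambda>_. 1) u v"

definition packing_total_coloring :: "'a pair_pre_digraph \<Rightarrow> ('a + 'a set \<Rightarrow> nat) \<Rightarrow> bool" where
  "packing_total_coloring G c \<longleftrightarrow>
     (\<forall>A \<in> pverts (total_graph G). 1 \<le> c A) \<and>
     (\<forall>A \<in> pverts (total_graph G). \<forall>B \<in> pverts (total_graph G).
        A \<noteq> B \<longrightarrow> c A = c B \<longrightarrow> graph_dist (total_graph G) A B > ereal (real (c A)))"

definition packing_total_chromatic_number :: "'a pair_pre_digraph \<Rightarrow> nat" where
  "packing_total_chromatic_number G =
     (LEAST k. \<exists>c. packing_total_coloring G c \<and> c ` pverts (total_graph G) \<subseteq> {1..k})"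

text \<open>The minimum is attained: injective colorings of a finite graph are packing total colorings.\<close>

lemma ex_packing_total_coloring:
  assumes "pair_graph G"
  shows "\<exists>k c. packing_total_coloring G c \<and> c ` pverts (total_graph G) \<subseteq> {1..k}"
proof -
  interpret pair_graph "total_graph G"
    using assms by (rule pair_graph_total_graph)
  obtain f :: "'a + 'a set \<Rightarrow> nat" and n
    where f: "f ` pverts (total_graph G) = {i. i < n}" "inj_on f (pverts (total_graph G))"
    using finite_imp_inj_to_nat_seg[OF pair_finite_verts] by blast
  have "packing_total_coloring G (Suc \<circ> f)"
    using f(2) by (auto simp: packing_total_coloring_def dest: inj_onD)
  moreover have "(Suc \<circ> f) ` pverts (total_graph G) \<subseteq> {1..n}"
  proof
    fix k assume "k \<in> (Suc \<circ> f) ` pverts (total_graph G)"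
    then obtain A where "A \<in> pverts (total_graph G)" "k = Suc (f A)" by auto
    moreover from this have "f A \<in> {i. i < n}" using f(1) by blast
    ultimately show "k \<in> {1..n}" by simp
  qed
  ultimately show ?thesis
    by blast
qed

text \<open>A simple graph only for \<open>n \<ge> 3\<close>: there is a loop for \<open>n = 1\<close> and a single edge for \<open>n = 2\<close>.\<close>

definition cycle_graph :: "nat \<Rightarrow> nat pair_pre_digraph" where
  "cycle_graph n =
     \<lparr> pverts = {0..<n},
       parcs = {(i, j). i < n \<and> j < n \<and> (j = Suc i mod n \<or> i = Suc j mod n)} \<rparr>"

lemma pair_graph_cycle_graph:
  assumes "3 \<le> n"
  shows "pair_graph (cycle_graph n)"
proof -
  have arcs: "parcs (cycle_graph n) \<subseteq> {0..<n} \<times> {0..<n}"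
    by (auto simp: cycle_graph_def)
  show ?thesis
  proof
    show "finite (parcs (cycle_graph n))"
      using finite_subset[OF arcs] by simp
    show "symmetric (with_proj (cycle_graph n))"
      by (auto simp: symmetric_def cycle_graph_def intro!: symI)
    show "fst e \<noteq> snd e" if "e \<in> parcs (cycle_graph n)" for e
      using that assms by (auto simp: cycle_graph_def mod_Suc split: if_splits)
  qed (auto simp: cycle_graph_def)
qed

end

theory Submission
  imports Defs "HOL-Number_Theory.Cong"
begin

text \<open>
  Listing vertices and edges of \<open>C\<^sub>n\<close> alternately identifies its total graph with the square of
  the cycle \<open>C\<^sub>2\<^sub>n\<close>, so two elements of color \<open>i\<close> must lie more than \<open>2i\<close> steps apart on a cycle
  of length \<open>2n\<close>. Color \<open>i\<close> is therefore used at most \<open>max 1 (2n div (2i + 1))\<close> times, and summing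
  over the colors gives all the lower bounds. The upper bounds for \<open>n \<le> 12\<close> are explicit colorings.
  For \<open>n \<ge> 13\<close>, there are words of lengths \<open>26, 28, \<dots>, 50\<close> over \<open>11\<close> colors, all starting
  with the same \<open>22\<close> letters, which can be concatenated freely; their lengths generate all even
  numbers from \<open>26\<close> on. All words were found with a SAT solver.
\<close>

section \<open>The total graph of a cycle\<close>

text \<open>Integer indices let \<open>i + 1\<close> and \<open>i - 1\<close> name the neighbours of
  \<open>i\<close> with no case distinction where the cycle closes.\<close>

definition cycle_vertex :: "nat \<Rightarrow> int \<Rightarrow> nat" where
  "cycle_vertex n i = nat (i mod int n)"

definition cycle_edge :: "nat \<Rightarrow> int \<Rightarrow> nat set" where
  "cycle_edge n i = {cycle_vertex n i, cycle_vertex n (i + 1)}"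

text \<open>\<open>div\<close> rounds down on negative integers too, so position
  \<open>2 * i + 1\<close> is the edge between positions \<open>2 * i\<close> and
  \<open>2 * i + 2\<close> for every integer \<open>i\<close>.\<close>

definition cycle_elem :: "nat \<Rightarrow> int \<Rightarrow> nat + nat set" where
  "cycle_elem n k =
     (if even k then Inl (cycle_vertex n (k div 2)) else Inr (cycle_edge n (k div 2)))"

lemma cycle_elem_double [simp]: "cycle_elem n (2 * i) = Inl (cycle_vertex n i)"
  by (simp add: cycle_elem_def)

lemma cycle_elem_double_Suc [simp]: "cycle_elem n (2 * i + 1) = Inr (cycle_edge n i)"
  by (simp add: cycle_elem_def)

lemma cycle_elem_cases:
  obtains (vertex) i where "p = 2 * i" | (edge) i where "p = 2 * i + (1::int)"
  by (metis evenE oddE)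

lemma cycle_vertex_eq_iff:
  assumes "0 < n"
  shows "cycle_vertex n i = cycle_vertex n j \<longleftrightarrow> [i = j] (mod int n)"
  using assms by (simp add: cycle_vertex_def cong_def nat_eq_iff)

lemma cycle_vertex_shift:
  assumes "0 < n" "cycle_vertex n (i + a) = cycle_vertex n (j + b)"
  shows "cycle_vertex n i = cycle_vertex n (j + (b - a))"
  using assms by (simp add: cycle_vertex_eq_iff cong_iff_dvd_diff algebra_simps)

lemma cycle_edge_eq:
  assumes "0 < n" "cycle_vertex n i = cycle_vertex n j"
  shows "cycle_edge n i = cycle_edge n j"
proof -
  have "cycle_vertex n (i + 1) = cycle_vertex n (j + 1)"
    using assms by (simp add: cycle_vertex_eq_iff cong_iff_dvd_diff)
  with assms show ?thesis by (simp add: cycle_edge_def)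
qed

lemma cycle_vertex_less: "0 < n \<Longrightarrow> cycle_vertex n i < n"
  by (simp add: cycle_vertex_def nat_less_iff)

lemma cycle_vertex_of_nat: "i < n \<Longrightarrow> cycle_vertex n (int i) = i"
  by (simp add: cycle_vertex_def)

lemma cycle_vertex_Suc_of_nat: "cycle_vertex n (int i + 1) = Suc i mod n"
proof -
  have "(int i + 1) mod int n = int (Suc i mod n)"
    by (simp add: zmod_int add.commute)
  then show ?thesis by (simp add: cycle_vertex_def)
qed

lemma cycle_vertex_Suc:
  assumes "0 < n"
  shows "Suc (cycle_vertex n i) mod n = cycle_vertex n (i + 1)"
proof -
  have "Suc (cycle_vertex n i) mod n = cycle_vertex n (int (cycle_vertex n i) + 1)"
    by (simp only: cycle_vertex_Suc_of_nat)
  also have "\<dots> = cycle_vertex n (i + 1)"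
    using assms by (simp add: cycle_vertex_def mod_add_left_eq)
  finally show ?thesis .
qed

lemma parcs_cycle_graph_iff:
  assumes "0 < n"
  shows "(u, v) \<in> parcs (cycle_graph n) \<longleftrightarrow>
    (\<exists>i. u = cycle_vertex n i \<and> (v = cycle_vertex n (i + 1) \<or> v = cycle_vertex n (i - 1)))"
    (is "?L \<longleftrightarrow> ?R")
proof
  assume ?L
  then have *: "u < n" "v < n" "v = Suc u mod n \<or> u = Suc v mod n"
    by (auto simp: cycle_graph_def)
  from *(3) show ?R
  proof
    assume "v = Suc u mod n"
    with * show ?R
      by (metis cycle_vertex_of_nat cycle_vertex_Suc_of_nat)
  next
    assume "u = Suc v mod n"
    with * have "u = cycle_vertex n (int v + 1)" "v = cycle_vertex n (int v + 1 - 1)"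
      by (simp_all add: cycle_vertex_of_nat cycle_vertex_Suc_of_nat)
    then show ?R by blast
  qed
next
  assume ?R
  then show ?L
    using assms cycle_vertex_Suc[OF assms] cycle_vertex_less[OF assms]
    by (auto simp: cycle_graph_def)
qed

lemma pverts_cycle_graph: "0 < n \<Longrightarrow> pverts (cycle_graph n) = range (cycle_vertex n)"
  by (auto simp: cycle_graph_def cycle_vertex_less) (metis cycle_vertex_of_nat rangeI)

lemma uedges_cycle_graph:
  assumes "0 < n"
  shows "uedges (cycle_graph n) = range (cycle_edge n)"
proof -
  have "{cycle_vertex n i, cycle_vertex n (i - 1)} = cycle_edge n (i - 1)" for i
    by (auto simp: cycle_edge_def)
  then show ?thesis
    unfolding uedges_def parcs_cycle_graph_iff[OF assms]
    by (fastforce simp: cycle_edge_def)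
qed

lemma pverts_total_cycle:
  assumes "0 < n"
  shows "pverts (total_graph (cycle_graph n)) = range (cycle_elem n)"
proof -
  have "range (cycle_elem n) = Inl ` range (cycle_vertex n) \<union> Inr ` range (cycle_edge n)"
  proof (intro equalityI subsetI)
    fix A assume "A \<in> range (cycle_elem n)"
    then obtain p where "A = cycle_elem n p" by blast
    then show "A \<in> Inl ` range (cycle_vertex n) \<union> Inr ` range (cycle_edge n)"
      by (cases p rule: cycle_elem_cases) auto
  next
    fix A assume "A \<in> Inl ` range (cycle_vertex n) \<union> Inr ` range (cycle_edge n)"
    then show "A \<in> range (cycle_elem n)"
      by (auto simp flip: cycle_elem_double cycle_elem_double_Suc)
  qed
  then show ?thesis
    using assms by (simp add: total_graph_def pverts_cycle_graph uedges_cycle_graph Plus_def)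
qed

lemma cycle_edge_meet:
  assumes "0 < n" "cycle_edge n i \<inter> cycle_edge n j \<noteq> {}"
  shows "\<exists>d. \<bar>d\<bar> \<le> 1 \<and> cycle_edge n j = cycle_edge n (i + d)"
proof -
  \<comment> \<open>One of the four pairs of endpoints agrees. The summand \<open>+ 0\<close> in the
    second case fits it to \<open>cycle_vertex_shift\<close>.\<close>
  consider "cycle_vertex n j = cycle_vertex n i" | "cycle_vertex n (j + 1) = cycle_vertex n (i + 0)"
    | "cycle_vertex n (j + 0) = cycle_vertex n (i + 1)"
    | "cycle_vertex n (j + 1) = cycle_vertex n (i + 1)"
    using assms(2) by (auto simp: cycle_edge_def)
  then obtain d where "\<bar>d\<bar> \<le> 1" "cycle_vertex n j = cycle_vertex n (i + d)"
  proof cases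
    case 1 then show ?thesis using that[of 0] by simp
  next
    case 2 then show ?thesis using that[of "-1"] cycle_vertex_shift[OF assms(1) 2] by simp
  next
    case 3 then show ?thesis using that[of 1] by simp
  next
    case 4 then show ?thesis using that[of 0] cycle_vertex_shift[OF assms(1) 4] by simp
  qed
  then show ?thesis using cycle_edge_eq[OF assms(1)] by blast
qed

text \<open>If the endpoints agreed crosswise, \<open>i - (j + 1)\<close> and
  \<open>i + 1 - j\<close> would both be multiples of \<open>n\<close>, and so would their
  difference 2. For \<open>n = 2\<close> the two edges do coincide.\<close>

lemma cycle_edge_eq_iff:
  assumes "3 \<le> n"
  shows "cycle_edge n i = cycle_edge n j \<longleftrightarrow> [i = j] (mod int n)"
proof
  assume eq: "cycle_edge n i = cycle_edge n j"
  show "[i = j] (mod int n)"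
  proof (rule ccontr)
    assume "\<not> [i = j] (mod int n)"
    then have "[i = j + 1] (mod int n)" "[i + 1 = j] (mod int n)"
      using eq assms by (auto simp: cycle_edge_def doubleton_eq_iff cycle_vertex_eq_iff)
    then have "int n dvd 2"
      using dvd_diff[of "int n" "i + 1 - j" "i - (j + 1)"] by (simp add: cong_iff_dvd_diff)
    then show False using assms zdvd_imp_le by fastforce
  qed
next
  assume "[i = j] (mod int n)"
  then show "cycle_edge n i = cycle_edge n j"
    using assms by (intro cycle_edge_eq) (auto simp: cycle_vertex_eq_iff)
qed

text \<open>The modulus is even, so congruent positions have the same parity, as equal elements do;
  within one parity, halving turns the congruence into one modulo \<open>n\<close>.\<close>

lemma cycle_elem_eq_iff:
  assumes "3 \<le> n"
  shows "cycle_elem n p = cycle_elem n q \<longleftrightarrow> [p = q] (mod 2 * int n)"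
proof -
  have odd: "\<not> 2 * int n dvd k" if "odd k" for k
    using that by (metis dvd_mult_left)
  have dbl: "2 * int n dvd 2 * i - 2 * j \<longleftrightarrow> int n dvd i - j" for i j
    by (simp only: right_diff_distrib[symmetric] dvd_mult_cancel_left) simp
  show ?thesis
    using assms
    by (cases p rule: cycle_elem_cases; cases q rule: cycle_elem_cases)
       (simp_all add: cycle_vertex_eq_iff cycle_edge_eq_iff cong_iff_dvd_diff dbl odd)
qed

text \<open>This feeds the bound on how far a walk can get, so displacement 0 is allowed among the
  possible \<open>d\<close>.\<close>

lemma parcs_total_cycleD:
  assumes n: "0 < n" and arc: "(cycle_elem n p, B) \<in> parcs (total_graph (cycle_graph n))"
  shows "\<exists>d. \<bar>d\<bar> \<le> 2 \<and> B = cycle_elem n (p + d)"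
proof -
  have I: ?thesis if "B = cycle_elem n q" "\<bar>q - p\<bar> \<le> 2" for q
    using that by (intro exI[of _ "q - p"]) simp
  show ?thesis
  proof (cases p rule: cycle_elem_cases)
    case (vertex i)
    from arc vertex consider
        (v) v where "B = Inl v" "(cycle_vertex n i, v) \<in> parcs (cycle_graph n)"
      | (e) j where "B = Inr (cycle_edge n j)" "cycle_vertex n i \<in> cycle_edge n j"
      using n by (auto simp: total_graph_def uedges_cycle_graph)
    then show ?thesis
    proof cases
      case v
      then obtain j where j: "cycle_vertex n i = cycle_vertex n j"
        "v = cycle_vertex n (j + 1) \<or> v = cycle_vertex n (j - 1)"
        using n by (auto simp: parcs_cycle_graph_iff)
      have "cycle_vertex n (j + d) = cycle_vertex n (i + d)" for d
        using j(1) n by (simp add: cycle_vertex_eq_iff cong_iff_dvd_diff dvd_diff_commute)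
      from this[of 1] this[of "-1"] j(2)
      have "v = cycle_vertex n (i + 1) \<or> v = cycle_vertex n (i - 1)" by simp
      then have "B = cycle_elem n (2 * (i + 1)) \<or> B = cycle_elem n (2 * (i - 1))"
        unfolding cycle_elem_double v(1) by blast
      then show ?thesis
        by (elim disjE) (erule I, simp add: vertex)+
    next
      case e
      then have "cycle_vertex n j = cycle_vertex n i
        \<or> cycle_vertex n (j + 1) = cycle_vertex n (i + 0)"
        by (auto simp: cycle_edge_def)
      then have "cycle_vertex n j = cycle_vertex n i
        \<or> cycle_vertex n j = cycle_vertex n (i - 1)"
        using cycle_vertex_shift[OF n, of j 1 i 0] by auto
      then have "B = cycle_elem n (2 * i + 1) \<or> B = cycle_elem n (2 * (i - 1) + 1)"
        unfolding cycle_elem_double_Suc e(1) using cycle_edge_eq[OF n] by blast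
      then show ?thesis
        by (elim disjE) (erule I, simp add: vertex)+
    qed
  next
    case (edge i)
    from arc edge consider
        (e) j where "B = Inr (cycle_edge n j)" "cycle_edge n i \<inter> cycle_edge n j \<noteq> {}"
      | (v) v where "B = Inl v" "v \<in> cycle_edge n i"
      using n by (auto simp: total_graph_def uedges_cycle_graph)
    then show ?thesis
    proof cases
      case e
      then obtain d where d: "\<bar>d\<bar> \<le> 1" "B = cycle_elem n (2 * (i + d) + 1)"
        using cycle_edge_meet[OF n] by (metis cycle_elem_double_Suc)
      show ?thesis
        by (rule I[OF d(2)]) (use d(1) edge in \<open>simp add: abs_le_iff\<close>)
    next
      case v
      then have "B = cycle_elem n (2 * i) \<or> B = cycle_elem n (2 * (i + 1))"
        unfolding cycle_elem_double cycle_edge_def by blast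
      then show ?thesis
        by (elim disjE) (erule I, simp add: edge)+
    qed
  qed
qed

lemma parcs_total_cycleI:
  assumes n: "3 \<le> n" and d: "d = 1 \<or> d = 2"
  shows "(cycle_elem n p, cycle_elem n (p + d)) \<in> parcs (total_graph (cycle_graph n))"
    and "(cycle_elem n (p + d), cycle_elem n p) \<in> parcs (total_graph (cycle_graph n))"
proof -
  have n0: "0 < n" using n by simp
  have sym: "(B, A) \<in> parcs (total_graph (cycle_graph n))"
    if "(A, B) \<in> parcs (total_graph (cycle_graph n))" for A B
    using pair_graph_total_graph[OF pair_graph_cycle_graph[OF n]] that
    by (auto simp: pair_graph_def pair_pseudo_graph_def pair_sym_digraph_def
        pair_sym_digraph_axioms_def symmetric_def dest: symD)
  show arc: "(cycle_elem n p, cycle_elem n (p + d)) \<in> parcs (total_graph (cycle_graph n))"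
  proof (cases p rule: cycle_elem_cases)
    case (vertex i)
    show ?thesis
    proof (cases "d = 1")
      case True
      then show ?thesis using n0 vertex
        by (simp add: total_graph_def uedges_cycle_graph cycle_edge_def)
    next
      case False
      then have "p + d = 2 * (i + 1)" using d vertex by simp
      then show ?thesis using n0 vertex
        by (simp only: cycle_elem_double)
           (auto simp: total_graph_def uedges_cycle_graph parcs_cycle_graph_iff)
    qed
  next
    case (edge i)
    show ?thesis
    proof (cases "d = 1")
      case True
      then have "p + d = 2 * (i + 1)" using edge by simp
      then show ?thesis using n0 edge
        by (simp only: cycle_elem_double cycle_elem_double_Suc)
           (simp add: total_graph_def uedges_cycle_graph cycle_edge_def)
    next
      case False
      then have pd: "p + d = 2 * (i + 1) + 1" using d edge by simp
      \<comment> \<open>Edges are adjacent in \<open>total_graph\<close> only if distinct, so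
        consecutive edges must be shown to differ.\<close>
      have "\<not> int n dvd 1" using n by simp
      then have "cycle_edge n i \<noteq> cycle_edge n (i + 1)"
        using n by (simp add: cycle_edge_eq_iff cong_iff_dvd_diff)
      moreover have "cycle_edge n i \<inter> cycle_edge n (i + 1) \<noteq> {}"
        by (auto simp: cycle_edge_def)
      ultimately show ?thesis using n0 edge unfolding pd
        by (simp only: cycle_elem_double_Suc)
           (simp add: total_graph_def uedges_cycle_graph)
    qed
  qed
  then show "(cycle_elem n (p + d), cycle_elem n p) \<in> parcs (total_graph (cycle_graph n))"
    by (rule sym)
qed

section \<open>Distances and packing colorings in terms of positions\<close>

text \<open>An arc moves by at most two positions, and moves by one or two positions are available
  in both directions, so \<open>k\<close> arcs can cover any displacement up to \<open>2 * k\<close>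
  and no more.\<close>

lemma graph_dist_cycle_elem_le_iff:
  assumes n: "3 \<le> n"
  shows "graph_dist (total_graph (cycle_graph n)) (cycle_elem n p) B \<le> ereal (real k)
    \<longleftrightarrow> (\<exists>d. \<bar>d\<bar> \<le> 2 * int k \<and> B = cycle_elem n (p + d))"
proof -
  have n0: "0 < n" using n by simp
  let ?T = "total_graph (cycle_graph n)"
  interpret pair_graph ?T
    using n by (intro pair_graph_total_graph pair_graph_cycle_graph)
  have cost: "awalk_cost (\<lambda>_. 1) es = real (length es)" for es
    by (induction es) auto
  have len: "\<exists>d. \<bar>d\<bar> \<le> 2 * int (length es) \<and> B = cycle_elem n (p + d)"
    if "awalk (cycle_elem n p) es B" for es p
    using that
  proof (induction es arbitrary: p)
    case Nil
    then show ?case by (auto simp: awalk_Nil_iff)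
  next
    case (Cons a es)
    then have arc: "(cycle_elem n p, snd a) \<in> parcs ?T" and w: "awalk (snd a) es B"
      by (auto simp: awalk_Cons_iff)
    obtain d where d: "\<bar>d\<bar> \<le> 2" "snd a = cycle_elem n (p + d)"
      using parcs_total_cycleD[OF n0 arc] by blast
    obtain d' where "\<bar>d'\<bar> \<le> 2 * int (length es)" "B = cycle_elem n (p + d + d')"
      using Cons.IH w d(2) by metis
    with d show ?case by (intro exI[of _ "d + d'"]) (simp add: algebra_simps)
  qed
  have walk: "\<exists>es. awalk (cycle_elem n p) es (cycle_elem n (p + d)) \<and> length es \<le> k"
    if "\<bar>d\<bar> \<le> 2 * int k" for d k p
    using that
  proof (induction k arbitrary: d p)
    case 0
    then show ?case
      using pverts_total_cycle[OF n0] by (auto simp: awalk_Nil_iff intro!: exI[of _ "[]"])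
  next
    case (Suc k)
    show ?case
    proof (cases "d = 0")
      case True
      then show ?thesis
        using pverts_total_cycle[OF n0] by (auto simp: awalk_Nil_iff intro!: exI[of _ "[]"])
    next
      case False
      \<comment> \<open>Greedy first move towards the target: it shortens the displacement by 2, or
        to 0 when it is 1 or -1.\<close>
      define s :: int where "s = (if 2 \<le> d then 2 else if d = 1 then 1 else if d = -1 then -1 else - 2)"
      have "s = 1 \<or> s = 2 \<or> - s = 1 \<or> - s = 2" by (auto simp: s_def)
      \<comment> \<open>A negative \<open>s\<close> is the step \<open>- s\<close> from
        \<open>p + s\<close>, traversed backwards.\<close>
      then have arc: "(cycle_elem n p, cycle_elem n (p + s)) \<in> parcs ?T"
        using parcs_total_cycleI(1)[OF n, of s p] parcs_total_cycleI(2)[OF n, of "- s" "p + s"]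
        by auto
      have "\<bar>d - s\<bar> \<le> 2 * int k" using Suc.prems False by (auto simp: s_def)
      then obtain es where "awalk (cycle_elem n (p + s)) es (cycle_elem n (p + s + (d - s)))"
        "length es \<le> k"
        using Suc.IH by blast
      then show ?thesis
        using arc
        by (intro exI[of _ "(cycle_elem n p, cycle_elem n (p + s)) # es"])
           (auto simp: awalk_Cons_iff)
    qed
  qed
  show ?thesis
  proof
    assume le: "graph_dist ?T (cycle_elem n p) B \<le> ereal (real k)"
    \<comment> \<open>The distance is an infimum; a strict bound yields an actual walk, and by
      integrality length below \<open>k + 1\<close> means at most \<open>k\<close>.\<close>
    have "graph_dist ?T (cycle_elem n p) B < ereal (real k + 1)"
      using le by (rule le_less_trans) simp
    then obtain es where "awalk (cycle_elem n p) es B" "real (length es) < real k + 1"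
      unfolding graph_dist_def \<mu>_def INF_less_iff by (auto simp: cost)
    then have "length es \<le> k" by linarith
    moreover obtain d where "\<bar>d\<bar> \<le> 2 * int (length es)" "B = cycle_elem n (p + d)"
      using len[OF \<open>awalk (cycle_elem n p) es B\<close>] by blast
    ultimately show "\<exists>d. \<bar>d\<bar> \<le> 2 * int k \<and> B = cycle_elem n (p + d)"
      by (intro exI[of _ d]) linarith
  next
    assume "\<exists>d. \<bar>d\<bar> \<le> 2 * int k \<and> B = cycle_elem n (p + d)"
    then obtain es where es: "awalk (cycle_elem n p) es B" "length es \<le> k"
      using walk by blast
    have "graph_dist ?T (cycle_elem n p) B \<le> ereal (real (length es))"
      using min_cost_le_walk_cost[OF es(1), of "\<lambda>_. 1"] by (simp add: graph_dist_def cost)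
    then show "graph_dist ?T (cycle_elem n p) B \<le> ereal (real k)"
      by (rule order_trans) (use es(2) in simp)
  qed
qed

text \<open>Displacements \<open>d\<close> range over all integers, so both ways around the cycle
  are covered; multiples of \<open>2 * int n\<close> return to the same element.\<close>

lemma packing_total_coloring_cycle_iff:
  assumes n: "3 \<le> n"
  shows "packing_total_coloring (cycle_graph n) c \<longleftrightarrow>
    (\<forall>p. 1 \<le> c (cycle_elem n p)) \<and>
    (\<forall>p d. \<not> 2 * int n dvd d \<longrightarrow> c (cycle_elem n p) = c (cycle_elem n (p + d))
      \<longrightarrow> 2 * int (c (cycle_elem n p)) < \<bar>d\<bar>)"
    (is "_ \<longleftrightarrow> ?pos \<and> ?sep")
proof -
  have n0: "0 < n" using n by simp
  have ne: "cycle_elem n p \<noteq> cycle_elem n (p + d) \<longleftrightarrow> \<not> 2 * int n dvd d" for p d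
    using n by (simp add: cycle_elem_eq_iff cong_iff_dvd_diff)
  have "packing_total_coloring (cycle_graph n) c \<longleftrightarrow> ?pos \<and>
    (\<forall>p B. B \<in> range (cycle_elem n) \<longrightarrow> cycle_elem n p \<noteq> B \<longrightarrow> c (cycle_elem n p) = c B \<longrightarrow>
      \<not> (\<exists>d. \<bar>d\<bar> \<le> 2 * int (c (cycle_elem n p)) \<and> B = cycle_elem n (p + d)))"
    unfolding packing_total_coloring_def pverts_total_cycle[OF n0]
    by (simp add: graph_dist_cycle_elem_le_iff[OF n, symmetric] not_le) blast
  also have "\<dots> \<longleftrightarrow> ?pos \<and> ?sep"
  proof (intro conj_cong refl iffI allI impI notI)
    fix p d
    assume "\<forall>p B. B \<in> range (cycle_elem n) \<longrightarrow> cycle_elem n p \<noteq> B \<longrightarrow> c (cycle_elem n p) = c B \<longrightarrow>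
        \<not> (\<exists>d. \<bar>d\<bar> \<le> 2 * int (c (cycle_elem n p)) \<and> B = cycle_elem n (p + d))"
      and "\<not> 2 * int n dvd d" "c (cycle_elem n p) = c (cycle_elem n (p + d))"
    then have "\<not> (\<exists>d'. \<bar>d'\<bar> \<le> 2 * int (c (cycle_elem n p)) \<and>
        cycle_elem n (p + d) = cycle_elem n (p + d'))"
      using ne by blast
    then show "2 * int (c (cycle_elem n p)) < \<bar>d\<bar>"
      using not_le by blast
  next
    fix p B
    assume sep: "\<forall>p d. \<not> 2 * int n dvd d \<longrightarrow>
        c (cycle_elem n p) = c (cycle_elem n (p + d)) \<longrightarrow> 2 * int (c (cycle_elem n p)) < \<bar>d\<bar>"
      and B: "cycle_elem n p \<noteq> B" "c (cycle_elem n p) = c B"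
      and "\<exists>d. \<bar>d\<bar> \<le> 2 * int (c (cycle_elem n p)) \<and> B = cycle_elem n (p + d)"
    then obtain d where "\<bar>d\<bar> \<le> 2 * int (c (cycle_elem n p))" "B = cycle_elem n (p + d)"
      by blast
    with sep B ne show False using not_le by blast
  qed
  finally show ?thesis .
qed

section \<open>Upper and lower bounds on the chromatic number from colorability\<close>

definition colorable :: "'a pair_pre_digraph \<Rightarrow> nat \<Rightarrow> bool" where
  "colorable G k \<longleftrightarrow>
     (\<exists>c. packing_total_coloring G c \<and> c ` pverts (total_graph G) \<subseteq> {1..k})"

lemma packing_total_chromatic_number_le:
  "colorable G k \<Longrightarrow> packing_total_chromatic_number G \<le> k"
  unfolding packing_total_chromatic_number_def colorable_def by (rule Least_le)

text \<open>The least number of colors is attained, and a coloring with fewer colors is also one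
  with \<open>k\<close>, so failure at \<open>k\<close> rules out every smaller number as
  well.\<close>

lemma less_packing_total_chromatic_number:
  assumes "pair_graph G" "\<not> colorable G k"
  shows "k < packing_total_chromatic_number G"
proof (rule ccontr)
  assume le: "\<not> k < packing_total_chromatic_number G"
  have "colorable G (packing_total_chromatic_number G)"
    using ex_packing_total_coloring[OF assms(1)]
    unfolding packing_total_chromatic_number_def colorable_def by (rule LeastI_ex)
  then obtain c where "packing_total_coloring G c"
    "c ` pverts (total_graph G) \<subseteq> {1..packing_total_chromatic_number G}"
    by (auto simp: colorable_def)
  moreover have "{1..packing_total_chromatic_number G} \<subseteq> {1..k}" using le by auto
  ultimately show False using assms(2) unfolding colorable_def by blast
qed

section \<open>Lower bounds by counting\<close>

text \<open>The blocks of \<open>r + 1\<close> consecutive integers starting at the points of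
  \<open>S\<close> are disjoint and fit into one window of length \<open>N\<close> starting at the
  least point. The \<open>max 1\<close> covers a single point, whose block may be longer than the
  window.\<close>

lemma card_cyclically_separated:
  fixes S :: "int set"
  assumes S: "S \<subseteq> {0..<int N}"
    and sep: "\<And>x y. x \<in> S \<Longrightarrow> y \<in> S \<Longrightarrow> x < y \<Longrightarrow> y - x > int r \<and> int N - (y - x) > int r"
  shows "card S \<le> max 1 (N div Suc r)"
proof (cases "card S \<le> 1")
  case True
  then show ?thesis by simp
next
  case False
  have fin: "finite S" using S finite_subset by blast
  have "S \<noteq> {}" using False by auto
  define a where "a = Min S"
  have a: "a \<in> S" "\<And>x. x \<in> S \<Longrightarrow> a \<le> x"
    using fin \<open>S \<noteq> {}\<close> by (auto simp: a_def)
  have "\<not> S \<subseteq> {a}"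
    using False card_mono[of "{a}" S] by auto
  then obtain y where y: "y \<in> S" "y \<noteq> a" by auto
  \<comment> \<open>A second point forces \<open>r < N\<close>, so the block of \<open>a\<close>
    itself fits into the window; for the other points the wrap-around gap to \<open>a\<close> does
    this.\<close>
  have Nr: "int r < int N" using sep[OF a(1) y(1)] a(2)[OF y(1)] y(2) by auto
  have disj: "{x..x + int r} \<inter> {y..y + int r} = {}" if "x \<in> S" "y \<in> S" "x \<noteq> y" for x y
    using sep[of x y] sep[of y x] that by (cases "x < y") auto
  have "card S * Suc r = (\<Sum>x\<in>S. card {x..x + int r})"
    by (simp add: nat_add_distrib)
  also have "\<dots> = card (\<Union>x\<in>S. {x..x + int r})"
    using fin disj by (subst card_UN_disjoint) auto
  also have "\<dots> \<le> card {a..a + int N - 1}"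
  proof (rule card_mono)
    show "(\<Union>x\<in>S. {x..x + int r}) \<subseteq> {a..a + int N - 1}"
    proof (intro UN_least)
      fix x assume x: "x \<in> S"
      have "x + int r \<le> a + int N - 1"
        using sep[OF a(1) x] a(2)[OF x] Nr by (cases "x = a") auto
      then show "{x..x + int r} \<subseteq> {a..a + int N - 1}" using a(2)[OF x] by auto
    qed
  qed simp
  also have "\<dots> = N" by simp
  finally have "card S \<le> N div Suc r"
    by (metis div_le_mono nonzero_mult_div_cancel_right nat.distinct(1))
  then show ?thesis by simp
qed

lemma colorable_cycle_imp_le:
  assumes n: "3 \<le> n" and col: "colorable (cycle_graph n) k"
  shows "2 * n \<le> (\<Sum>i = 1..k. max 1 (2 * n div (2 * i + 1)))"
proof -
  have n0: "0 < n" using n by simp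
  obtain c where c: "packing_total_coloring (cycle_graph n) c"
    "c ` range (cycle_elem n) \<subseteq> {1..k}"
    using col by (auto simp: colorable_def pverts_total_cycle[OF n0])
  define f where "f p = c (cycle_elem n p)" for p
  have sep: "2 * int (f p) < \<bar>d\<bar>" if "\<not> 2 * int n dvd d" "f p = f (p + d)" for p d
    using c(1) that unfolding packing_total_coloring_cycle_iff[OF n] f_def by blast
  have "cycle_elem n (p + 2 * int n) = cycle_elem n p" for p
    using n by (simp add: cycle_elem_eq_iff cong_def)
  then have per: "f (p + 2 * int n) = f p" for p
    by (simp add: f_def)
  define S where "S i = {p \<in> {0..<2 * int n}. f p = i}" for i
  have card_S: "card (S i) \<le> max 1 (2 * n div (2 * i + 1))" for i
  proof -
    have "card (S i) \<le> max 1 (2 * n div Suc (2 * i))"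
    proof (rule card_cyclically_separated)
      fix x y assume xy: "x \<in> S i" "y \<in> S i" "x < y"
      then have nd: "\<not> 2 * int n dvd y - x"
        using zdvd_imp_le[of "2 * int n" "y - x"] by (auto simp: S_def)
      \<comment> \<open>The second gap runs from \<open>y\<close> onwards to the copy of
        \<open>x\<close> one turn later, which has the same color by \<open>per\<close>.\<close>
      then have "\<not> 2 * int n dvd x + 2 * int n - y"
        using dvd_diff[of "2 * int n" "2 * int n" "x + 2 * int n - y"] by (auto simp: algebra_simps)
      with nd show "int (2 * i) < y - x \<and> int (2 * i) < int (2 * n) - (y - x)"
        using sep[of "y - x" x] sep[of "x + 2 * int n - y" y] per[of x] xy
        by (auto simp: S_def)
    qed (auto simp: S_def)
    then show ?thesis by simp
  qed
  have "{0..<2 * int n} = (\<Union>i\<in>{1..k}. S i)"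
    using c(2) by (fastforce simp: S_def f_def)
  then have "2 * n = card (\<Union>i\<in>{1..k}. S i)"
    by (metis card_atLeastLessThan_int diff_zero nat_int of_nat_mult of_nat_numeral)
  also have "\<dots> \<le> (\<Sum>i = 1..k. card (S i))"
    by (rule card_UN_le) simp
  also have "\<dots> \<le> (\<Sum>i = 1..k. max 1 (2 * n div (2 * i + 1)))"
    by (intro sum_mono card_S)
  finally show ?thesis .
qed

text \<open>Color \<open>i\<close> takes at most the fraction \<open>1 / (2 * i + 1)\<close> of all
  elements, and 1/3 + 1/5 + ... + 1/13 < 1. Adding 1/15 exceeds 1, so this estimate stops at 6
  colors.\<close>

lemma not_colorable_cycle_6:
  assumes "13 \<le> n"
  shows "\<not> colorable (cycle_graph n) 6"
proof
  assume "colorable (cycle_graph n) 6"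
  then have "2 * n \<le> (\<Sum>i = 1..6. max 1 (2 * n div (2 * i + 1)))"
    using assms by (intro colorable_cycle_imp_le) auto
  then have "real (2 * n) \<le> (\<Sum>i = 1..6. real (max 1 (2 * n div (2 * i + 1))))"
    by (metis of_nat_le_iff of_nat_sum)
  also have "\<dots> \<le> (\<Sum>i = (1::nat)..6. real (2 * n) / real (2 * i + 1))"
  proof (rule sum_mono)
    fix i :: nat assume "i \<in> {1..6}"
    \<comment> \<open>Since \<open>2 * i + 1\<close> is at most 13, the 1 in the maximum is absorbed
      by the fraction.\<close>
    then have "1 \<le> real (2 * n) / real (2 * i + 1)" using assms by (simp add: field_simps)
    moreover have "real (2 * n div (2 * i + 1)) \<le> real (2 * n) / real (2 * i + 1)"
      by (rule of_nat_div_le_of_nat)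
    ultimately show "real (max 1 (2 * n div (2 * i + 1))) \<le> real (2 * n) / real (2 * i + 1)"
      by (simp add: max_def)
  qed
  also have "\<dots> = real (2 * n) * (1/3 + 1/5 + 1/7 + 1/9 + 1/11 + 1/13)"
    by (simp add: eval_nat_numeral)
  also have "\<dots> < real (2 * n)" using assms by simp
  finally show False by simp
qed

section \<open>Upper bounds by explicit colorings\<close>

text \<open>A linear form of the separation condition that \<open>simp\<close> can evaluate on
  concrete words; the cyclic condition is recovered by appending the first \<open>m\<close>
  letters.\<close>

primrec spaced :: "nat \<Rightarrow> nat list \<Rightarrow> bool" where
  "spaced m [] \<longleftrightarrow> True"
| "spaced m (x # xs) \<longleftrightarrow> x \<notin> set (take (min m (2 * x)) xs) \<and> spaced m xs"

lemma spaced_nth_neq: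
  assumes "spaced m w" "0 < d" "p + d < length w" "d \<le> m" "d \<le> 2 * w ! p"
  shows "w ! p \<noteq> w ! (p + d)"
  using assms
proof (induction w arbitrary: p)
  case Nil
  then show ?case by simp
next
  case (Cons x xs)
  show ?case
  proof (cases p)
    case 0
    have "d - 1 < length (take (min m (2 * x)) xs)"
      using Cons.prems 0 by auto
    then have "xs ! (d - 1) \<in> set (take (min m (2 * x)) xs)"
      by (metis length_take min_less_iff_conj nth_mem nth_take)
    with Cons.prems 0 show ?thesis by (auto simp: nth_Cons')
  next
    case (Suc p')
    with Cons show ?thesis by auto
  qed
qed

text \<open>No window is longer than \<open>m\<close>, so those starting in \<open>xs\<close> end
  within \<open>ys\<close> at the latest and never see \<open>zs\<close>.\<close>

lemma spaced_append:
  assumes "spaced m (xs @ ys)" "spaced m (ys @ zs)" "m \<le> length ys"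
  shows "spaced m (xs @ ys @ zs)"
  using assms by (induction xs) auto

text \<open>
  The word is read around the cycle, vertices and edges alternating. A color that occurs only once
  may have a range exceeding the cycle, which is why the window is capped at one full turn.
\<close>

lemma colorable_cycle_if_spaced:
  assumes n: "3 \<le> n" and len: "length w = 2 * n" and col: "set w \<subseteq> {1..k}"
    and m: "m < 2 * n" "min (2 * k) (2 * n - 1) \<le> m"
    and sp: "spaced m (w @ take m w)"
  shows "colorable (cycle_graph n) k"
proof -
  have n0: "0 < n" using n by simp
  let ?N = "2 * int n"
  define f where "f p = w ! nat (p mod ?N)" for p
  \<comment> \<open>The choice of position does not matter: \<open>f\<close> is periodic, and
    positions of one element differ by full turns.\<close>
  define c where "c A = f (SOME p. A = cycle_elem n p)" for A
  have f_mem: "f p \<in> {1..k}" for p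
    using col len n0 by (force simp: f_def nat_less_iff)
  have c: "c (cycle_elem n p) = f p" for p
  proof -
    have "cycle_elem n p = cycle_elem n (SOME q. cycle_elem n p = cycle_elem n q)"
      by (rule someI) simp
    then show ?thesis
      unfolding c_def f_def by (simp add: cycle_elem_eq_iff[OF n] cong_def)
  qed
  have pos: "2 * int (f p) < d" if "\<not> ?N dvd d" "f p = f (p + d)" "0 < d" for p d
  proof (rule ccontr)
    assume "\<not> 2 * int (f p) < d"
    define p' d' where "p' = nat (p mod ?N)" and "d' = nat (d mod ?N)"
    have p': "int p' = p mod ?N" and d': "int d' = d mod ?N"
      using n0 by (simp_all add: p'_def d'_def)
    have p'_less: "p' < 2 * n" and d'_less: "d' < 2 * n"
      using n0 by (simp_all add: p'_def d'_def nat_less_iff)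
    have "d' \<noteq> 0" using that(1) d' by (auto simp: dvd_eq_mod_eq_0)
    \<comment> \<open>Reducing a positive displacement modulo a turn only shortens it, so a conflict
      at \<open>d\<close> is also one at \<open>d'\<close>.\<close>
    have "int d' \<le> d" unfolding d' using that(3) n0 by (simp add: zmod_le_nonneg_dividend)
    then have d'_le: "d' \<le> 2 * f p" using \<open>\<not> 2 * int (f p) < d\<close> by simp
    then have "d' \<le> m" using d'_less m(2) f_mem[of p] by auto
    have "int ((p' + d') mod (2 * n)) = (p + d) mod ?N"
      by (simp add: zmod_int p' d' mod_add_eq)
    then have "f (p + d) = w ! ((p' + d') mod (2 * n))"
      by (metis f_def nat_int)
    \<comment> \<open>Past the end of \<open>w\<close> the index overshoots by less than
      \<open>d'\<close>, hence by less than \<open>m\<close>, and lands in the appended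
      prefix.\<close>
    also have "\<dots> = (w @ take m w) ! (p' + d')"
      using p'_less d'_less \<open>d' \<le> m\<close> len
      by (cases "p' + d' < 2 * n") (simp_all add: nth_append le_mod_geq)
    also have "\<dots> \<noteq> (w @ take m w) ! p'"
      using spaced_nth_neq[OF sp, of d' p'] p'_less d'_less \<open>d' \<le> m\<close> \<open>d' \<noteq> 0\<close>
        len m(1) d'_le
      by (force simp: nth_append f_def p'_def)
    also have "(w @ take m w) ! p' = f p"
      using p'_less len by (simp add: nth_append f_def p'_def)
    finally show False using that(2) by simp
  qed
  have "2 * int (f p) < \<bar>d\<bar>" if "\<not> ?N dvd d" "f p = f (p + d)" for p d
  proof (cases "0 < d")
    case True
    then show ?thesis using pos[OF that] by simp
  next
    case False
    moreover have "d \<noteq> 0" using that(1) by auto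
    \<comment> \<open>A backward displacement is a forward one seen from its other end.\<close>
    ultimately show ?thesis using pos[of "- d" "p + d"] that by simp
  qed
  then have "packing_total_coloring (cycle_graph n) c"
    using f_mem by (auto simp: packing_total_coloring_cycle_iff[OF n] c)
  moreover have "c ` pverts (total_graph (cycle_graph n)) \<subseteq> {1..k}"
    using f_mem by (auto simp: pverts_total_cycle[OF n0] c)
  ultimately show ?thesis unfolding colorable_def by blast
qed

section \<open>Optimal words for \<open>n\<close> from 3 to 12\<close>

text \<open>In this and the next nine colorings \<open>m\<close> is \<open>2 * n - 1\<close>, one
  less than a full turn. The counting bound equals \<open>2 * n\<close> in each, so every color
  occurs exactly as often as it permits.\<close>

lemma colorable_cycle_3: "colorable (cycle_graph 3) 5"
  by (rule colorable_cycle_if_spaced[where m = 5 and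
        w = "[5, 4, 1, 3, 2, 1]"])
     simp_all

lemma colorable_cycle_4: "colorable (cycle_graph 4) 7"
  by (rule colorable_cycle_if_spaced[where m = 7 and
        w = "[7, 6, 5, 4, 1, 3, 2, 1]"])
     simp_all

lemma colorable_cycle_5: "colorable (cycle_graph 5) 7"
  by (rule colorable_cycle_if_spaced[where m = 9 and
        w = "[6, 7, 1, 2, 5, 4, 1, 3, 2, 1]"])
     simp_all

lemma colorable_cycle_6: "colorable (cycle_graph 6) 8"
  by (rule colorable_cycle_if_spaced[where m = 11 and
        w = "[8, 7, 1, 6, 2, 1, 5, 4, 1, 3, 2, 1]"])
     simp_all

lemma colorable_cycle_7: "colorable (cycle_graph 7) 9"
  by (rule colorable_cycle_if_spaced[where m = 13 and
        w = "[8, 9, 7, 1, 3, 6, 2, 1, 5, 4, 1, 3, 2, 1]"])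
     simp_all

lemma colorable_cycle_8: "colorable (cycle_graph 8) 9"
  by (rule colorable_cycle_if_spaced[where m = 15 and
        w = "[8, 9, 1, 2, 7, 3, 1, 6, 2, 1, 5, 4, 1, 3, 2, 1]"])
     simp_all

lemma colorable_cycle_9: "colorable (cycle_graph 9) 9"
  by (rule colorable_cycle_if_spaced[where m = 17 and
        w = "[9, 8, 1, 2, 4, 1, 7, 3, 1, 6, 2, 1, 5, 4, 1, 3, 2, 1]"])
     simp_all

lemma colorable_cycle_10: "colorable (cycle_graph 10) 10"
  by (rule colorable_cycle_if_spaced[where m = 19 and
        w = "[2, 3, 1, 4, 5, 2, 1, 6, 7, 1, 2, 3, 1, 8, 4, 2, 1, 10, 9, 1]"])
     simp_all

lemma colorable_cycle_11: "colorable (cycle_graph 11) 9"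
  by (rule colorable_cycle_if_spaced[where m = 21 and
        w = "[8, 9, 1, 2, 3, 5, 1, 4, 2, 1, 7, 3, 1, 6, 2, 1, 5, 4, 1, 3, 2, 1]"])
     simp_all

lemma colorable_cycle_12: "colorable (cycle_graph 12) 10"
  by (rule colorable_cycle_if_spaced[where m = 23 and
        w = "[10, 9, 1, 8, 2, 1, 3, 5, 1, 4, 2, 1, 7, 3, 1, 6, 2, 1, 5, 4, 1, 3, 2, 1]"])
     simp_all

section \<open>Concatenable words for \<open>n\<close> from 13 on\<close>

definition linking_word :: "nat list" where
  "linking_word = [1, 3, 5, 1, 2, 7, 1, 4, 3, 1, 6, 2, 1, 8, 5, 1, 3, 4, 1, 2, 9, 1]"

lemma length_linking_word [simp]: "length linking_word = 22"
  by
     (simp add: linking_word_def)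

lemma set_linking_word: "set linking_word \<subseteq> {1..11}"
  by
     (simp add: linking_word_def)

text \<open>The word placed on the cycle is \<open>linking_word @ u\<close>; the trailing copy
  stands for the start of the next turn, or of the next word in a concatenation.\<close>

definition linkable :: "nat \<Rightarrow> bool" where
  "linkable n \<longleftrightarrow> (\<exists>u. length u + 22 = 2 * n \<and> set u \<subseteq> {1..11} \<and>
     spaced 22 (linking_word @ u @ linking_word))"

text \<open>
  The length 22 of the linking word is the reach of color 11, so the words on its two sides do
  not interact.
\<close>

lemma linkable_add:
  assumes "linkable m" "linkable n"
  shows "linkable (m + n)"
proof -
  obtain u where u: "length u + 22 = 2 * m" "set u \<subseteq> {1..11}"
    "spaced 22 (linking_word @ u @ linking_word)"
    using assms(1) by (auto simp: linkable_def)
  obtain v where v: "length v + 22 = 2 * n" "set v \<subseteq> {1..11}"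
    "spaced 22 (linking_word @ v @ linking_word)"
    using assms(2) by (auto simp: linkable_def)
  have "spaced 22 (linking_word @ (u @ linking_word @ v) @ linking_word)"
    using spaced_append[of 22 "linking_word @ u" linking_word "v @ linking_word"] u(3) v(3)
    by simp
  then show ?thesis
    unfolding linkable_def using u(1,2) v(1,2) set_linking_word
    by (intro exI[of _ "u @ linking_word @ v"]) simp
qed

text \<open>Here and up to \<open>linkable_25\<close> the witness is only the middle part
  \<open>u\<close>, with \<open>2 * n - 22\<close> letters.\<close>

lemma linkable_13: "linkable 13"
  unfolding linkable_def
  by (rule exI[of _ "[10, 6, 2, 11]"])
     (simp add: linking_word_def)

lemma linkable_14: "linkable 14"
  unfolding linkable_def
  by (rule exI[of _ "[10, 6, 1, 11, 4, 2]"])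
     (simp add: linking_word_def)

lemma linkable_15: "linkable 15"
  unfolding linkable_def
  by (rule exI[of _ "[10, 3, 2, 1, 4, 6, 11, 2]"])
     (simp add: linking_word_def)

lemma linkable_16: "linkable 16"
  unfolding linkable_def
  by (rule exI[of _ "[7, 10, 3, 1, 2, 6, 4, 1, 11, 2]"])
     (simp add: linking_word_def)

lemma linkable_17: "linkable 17"
  unfolding linkable_def
  by (rule exI[of _ "[7, 10, 3, 1, 6, 2, 1, 4, 8, 1, 11, 2]"])
     (simp add: linking_word_def)

lemma linkable_18: "linkable 18"
  unfolding linkable_def
  by (rule exI[of _ "[7, 6, 1, 10, 5, 1, 3, 2, 1, 8, 4, 1, 11, 2]"])
     (simp add: linking_word_def)

lemma linkable_19: "linkable 19"
  unfolding linkable_def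
  by (rule exI[of _ "[11, 3, 1, 5, 7, 4, 1, 2, 10, 1, 3, 8, 6, 1, 4, 2]"])
     (simp add: linking_word_def)

lemma linkable_20: "linkable 20"
  unfolding linkable_def
  by (rule exI[of _ "[10, 6, 2, 7, 1, 3, 5, 4, 1, 8, 2, 1, 3, 11, 6, 1, 2, 9]"])
     (simp add: linking_word_def)

lemma linkable_21: "linkable 21"
  unfolding linkable_def
  by (rule exI[of _ "[11, 6, 3, 10, 1, 2, 5, 1, 4, 7, 2, 1, 8, 3, 1, 2, 6, 1, 4, 9]"])
     (simp add: linking_word_def)

lemma linkable_22: "linkable 22"
  unfolding linkable_def
  by (rule exI[of _ "[11, 10, 1, 7, 2, 1, 6, 3, 1, 2, 8, 4, 1, 5, 2, 1, 3, 9, 1, 6, 4, 2]"])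
     (simp add: linking_word_def)

lemma linkable_23: "linkable 23"
  unfolding linkable_def
  by (rule exI[of _ "[11, 6, 3, 1, 7, 2, 1, 4, 5, 1, 3, 10, 2, 1, 6, 8, 1, 2, 3, 9, 4, 1, 2, 11]"])
     (simp add: linking_word_def)

lemma linkable_24: "linkable 24"
  unfolding linkable_def
  by (rule exI[of _ "[7, 11, 1, 5, 10, 1, 6, 2, 1, 3, 8, 1, 2, 4, 5, 1, 7, 9, 1, 3, 2, 6, 1, 4, 11, 10]"])
     (simp add: linking_word_def)

lemma linkable_25: "linkable 25"
  unfolding linkable_def
  by (rule exI[of _ "[10, 7, 1, 3, 2, 1, 6, 5, 1, 4, 3, 1, 11, 2, 1, 8, 7, 1, 3, 5, 1, 9, 2, 10, 6, 1, 4,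
             2]"])
     (simp add: linking_word_def)

lemma linkable_if_ge:
  "13 \<le> n \<Longrightarrow> linkable n"
proof (induction n rule: less_induct)
  case (less n)
  show ?case
  proof (cases "n \<le> 25")
    case True
    with less.prems have "n \<in> {13, 14, 15, 16, 17, 18, 19, 20, 21, 22, 23, 24, 25}"
      by (simp only: insert_iff empty_iff) presburger
    then show ?thesis
      using linkable_13 linkable_14 linkable_15 linkable_16 linkable_17 linkable_18
        linkable_19 linkable_20 linkable_21 linkable_22 linkable_23 linkable_24 linkable_25
      by auto
  next
    case False
    \<comment> \<open>The base cases 13 to 25 cover every residue modulo 13, and
      \<open>n - 13\<close> is still at least 13.\<close>
    then have "linkable (n - 13)" by (intro less.IH) auto
    from linkable_add[OF this linkable_13] False show ?thesis by simp
  qed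
qed

text \<open>The first 22 letters of \<open>linking_word @ u\<close> are \<open>linking_word\<close>
  itself, so the trailing copy is exactly the wrap-around. From \<open>n = 12\<close> on, the reach
  22 of color 11 is less than a full turn.\<close>

lemma colorable_cycle_if_linkable:
  assumes "linkable n" "12 \<le> n"
  shows "colorable (cycle_graph n) 11"
proof -
  obtain u where "length u + 22 = 2 * n" "set u \<subseteq> {1..11}"
    "spaced 22 (linking_word @ u @ linking_word)"
    using assms(1) by (auto simp: linkable_def)
  then show ?thesis
    using set_linking_word assms(2)
    by (intro colorable_cycle_if_spaced[of n "linking_word @ u" 11 22]) simp_all
qed

lemma packing_total_chromatic_number_cycle_eqI:
  assumes "3 \<le> n" "colorable (cycle_graph n) (Suc k)"
    and "(\<Sum>i = 1..k. max 1 (2 * n div (2 * i + 1))) < 2 * n"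
  shows "packing_total_chromatic_number (cycle_graph n) = Suc k"
proof (rule antisym)
  show "packing_total_chromatic_number (cycle_graph n) \<le> Suc k"
    using assms(2) by (rule packing_total_chromatic_number_le)
  have "\<not> colorable (cycle_graph n) k"
    using colorable_cycle_imp_le[OF assms(1), of k] assms(3) by auto
  then show "Suc k \<le> packing_total_chromatic_number (cycle_graph n)"
    using less_packing_total_chromatic_number[OF pair_graph_cycle_graph[OF assms(1)]]
    by (simp add: Suc_le_eq)
qed

theorem theorem3p2:
  shows "packing_total_chromatic_number (cycle_graph 3) = 5
    \<and> (\<forall>n \<in> {4, 5}. packing_total_chromatic_number (cycle_graph n) = 7)
    \<and> packing_total_chromatic_number (cycle_graph 6) = 8
    \<and> (\<forall>n \<in> {7, 8, 9, 11}. packing_total_chromatic_number (cycle_graph n) = 9)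
    \<and> (\<forall>n \<in> {10, 12}. packing_total_chromatic_number (cycle_graph n) = 10)
    \<and> (\<forall>n \<ge> 13. 7 \<le> packing_total_chromatic_number (cycle_graph n)
              \<and> packing_total_chromatic_number (cycle_graph n) \<le> 11)"
proof -
  \<comment> \<open>In all ten cases the counting bound for one color fewer is
    \<open>2 * n - 1\<close>, just short of the number of elements; here 2 + 1 + 1 + 1 = 5.\<close>
  have chi_3: "packing_total_chromatic_number (cycle_graph 3) = 5"
    using packing_total_chromatic_number_cycle_eqI[of 3 4] colorable_cycle_3
    by (simp add: numeral_2_eq_2 atLeastAtMostSuc_conv sum.atLeast_Suc_atMost)
  have chi_4: "packing_total_chromatic_number (cycle_graph 4) = 7"
    using packing_total_chromatic_number_cycle_eqI[of 4 6] colorable_cycle_4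
    by (simp add: numeral_2_eq_2 atLeastAtMostSuc_conv sum.atLeast_Suc_atMost)
  have chi_5: "packing_total_chromatic_number (cycle_graph 5) = 7"
    using packing_total_chromatic_number_cycle_eqI[of 5 6] colorable_cycle_5
    by (simp add: numeral_2_eq_2 atLeastAtMostSuc_conv sum.atLeast_Suc_atMost)
  have chi_6: "packing_total_chromatic_number (cycle_graph 6) = 8"
    using packing_total_chromatic_number_cycle_eqI[of 6 7] colorable_cycle_6
    by (simp add: numeral_2_eq_2 atLeastAtMostSuc_conv sum.atLeast_Suc_atMost)
  have chi_7: "packing_total_chromatic_number (cycle_graph 7) = 9"
    using packing_total_chromatic_number_cycle_eqI[of 7 8] colorable_cycle_7
    by (simp add: numeral_2_eq_2 atLeastAtMostSuc_conv sum.atLeast_Suc_atMost)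
  have chi_8: "packing_total_chromatic_number (cycle_graph 8) = 9"
    using packing_total_chromatic_number_cycle_eqI[of 8 8] colorable_cycle_8
    by (simp add: numeral_2_eq_2 atLeastAtMostSuc_conv sum.atLeast_Suc_atMost)
  have chi_9: "packing_total_chromatic_number (cycle_graph 9) = 9"
    using packing_total_chromatic_number_cycle_eqI[of 9 8] colorable_cycle_9
    by (simp add: numeral_2_eq_2 atLeastAtMostSuc_conv sum.atLeast_Suc_atMost)
  have chi_10: "packing_total_chromatic_number (cycle_graph 10) = 10"
    using packing_total_chromatic_number_cycle_eqI[of 10 9] colorable_cycle_10
    by (simp add: numeral_2_eq_2 atLeastAtMostSuc_conv sum.atLeast_Suc_atMost)
  have chi_11: "packing_total_chromatic_number (cycle_graph 11) = 9"
    using packing_total_chromatic_number_cycle_eqI[of 11 8] colorable_cycle_11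
    by (simp add: numeral_2_eq_2 atLeastAtMostSuc_conv sum.atLeast_Suc_atMost)
  have chi_12: "packing_total_chromatic_number (cycle_graph 12) = 10"
    using packing_total_chromatic_number_cycle_eqI[of 12 9] colorable_cycle_12
    by (simp add: numeral_2_eq_2 atLeastAtMostSuc_conv sum.atLeast_Suc_atMost)
  note chi = chi_3 chi_4 chi_5 chi_6 chi_7 chi_8 chi_9 chi_10 chi_11 chi_12
  have "7 \<le> packing_total_chromatic_number (cycle_graph n)" if "13 \<le> n" for n
    using less_packing_total_chromatic_number[OF pair_graph_cycle_graph not_colorable_cycle_6, of n]
      that by simp
  moreover have "packing_total_chromatic_number (cycle_graph n) \<le> 11" if "13 \<le> n" for n
    using that
    by (intro packing_total_chromatic_number_le colorable_cycle_if_linkable linkable_if_ge) simp_all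
  ultimately show ?thesis
    using chi by auto
qed

end
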